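(* Let $X$ be a compact topological space endowed with an admissible family of open coverings $\mathcal{O}$. Let $(K_{\lambda})$ be a net in $\mathcal{H}(X)$, the set of nonempty closed subsets of $X$, and let $K\in\mathcal{H}(X)$. If $(K_{\lambda})$ is Kuratowski convergent to $K$, then $K_{\lambda}\rightarrow K$ in the uniform topology of $\mathcal{H}(X)$.
   Context: For coverings $\mathcal{U},\mathcal{V}$ of $X$, $\mathcal{V}\leqslant\frac12\mathcal{U}$ means: for all $V,V'\in\mathcal{V}$ with $V\cap V'\neq\emptyset$ there is $U\in\mathcal{U}$ with $V\cup V'\subset U$. Stars: $\mathrm{St}[Y,\mathcal{U}]=\bigcup\{U\in\mathcal{U}: Y\cap U\neq\emptyset\}$, $\mathrm{St}[x,\mathcal{U}]=\mathrm{St}[\{x\},\mathcal{U}]$. A family $\mathcal{O}$ of open coverings of $X$ is admissible if (1) for any $\mathcal{U},\mathcal{V}\in\mathcal{O}$ there is $\mathcal{W}\in\mathcal{O}$ with $\mathcal{W}\leqslant\frac12\mathcal{U}$ and $\mathcal{W}\leqslant\frac12\mathcal{V}$; and (2) the stars $\mathrm{St}[x,\mathcal{U}]$, $x\in X$, $\mathcal{U}\in\mathcal{O}$, form a basis for the topology of $X$. The uniform topology on $\mathcal{H}(X)$ is the topology of the diagonal uniformity with base the sets $D_{\mathcal{U}}=\bigcup\{\mathrm{B}_{H}(A,\mathcal{U})\times\mathrm{B}_{H}(A,\mathcal{U}):A\in\mathcal{H}(X)\}$, $\mathcal{U}\in\mathcal{O}$, where $\mathrm{B}_{H}(A,\mathcal{U})=\{B\in\mathcal{H}(X):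 A\subset\mathrm{St}[B,\mathcal{U}],\ B\subset\mathrm{St}[A,\mathcal{U}]\}$. For a net $(F_{\lambda})$ in $\mathcal{H}(X)$, $\mathcal{LS}(F_{\lambda})$ is the set of $x\in X$ such that every open neighborhood $U$ of $x$ satisfies $U\cap F_{\lambda}\neq\emptyset$ frequently (for every $\lambda_0$ there is $\lambda\geq\lambda_0$ with this property); $\mathcal{LI}(F_{\lambda})$ is the set of $x\in X$ such that every open neighborhood $U$ of $x$ satisfies $U\cap F_{\lambda}\neq\emptyset$ residually (for all $\lambda\geq\lambda_0$, for some $\lambda_0$). $(F_{\lambda})$ is Kuratowski convergent to $F\in\mathcal{H}(X)$ if $F=\mathcal{LS}(F_{\lambda})=\mathcal{LI}(F_{\lambda})$. *)

theory Defs
  imports "HOL-Analysis.Analysis"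
begin

section \<open>Admissible families of open coverings\<close>

definition open_covering :: "'a topology \<Rightarrow> 'a set set \<Rightarrow> bool" where
  "open_covering X \<U> \<longleftrightarrow> (\<forall>U\<in>\<U>. openin X U) \<and> \<Union>\<U> = topspace X"

definition half_refines :: "'a set set \<Rightarrow> 'a set set \<Rightarrow> bool" where
  "half_refines \<V> \<U> \<longleftrightarrow>
     (\<forall>V\<in>\<V>. \<forall>V'\<in>\<V>. V \<inter> V' \<noteq> {} \<longrightarrow> (\<exists>U\<in>\<U>. V \<union> V' \<subseteq> U))"

definition star_of_set :: "'a set \<Rightarrow> 'a set set \<Rightarrow> 'a set" where
  "star_of_set Y \<U> = \<Union>{U \<in> \<U>. Y \<inter> U \<noteq> {}}"

definition admissible :: "'a topology \<Rightarrow> 'a set set set \<Rightarrow> bool" where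
  "admissible X \<O> \<longleftrightarrow>
     (\<forall>\<U>\<in>\<O>. open_covering X \<U>) \<and>
     (\<forall>\<U>\<in>\<O>. \<forall>\<V>\<in>\<O>. \<exists>\<W>\<in>\<O>. half_refines \<W> \<U> \<and> half_refines \<W> \<V>) \<and>
     openin X = arbitrary union_of (\<lambda>S. \<exists>x\<in>topspace X. \<exists>\<U>\<in>\<O>. S = star_of_set {x} \<U>)"

section \<open>The hyperspace and its uniform topology\<close>

definition hyperspace :: "'a topology \<Rightarrow> 'a set set" where
  "hyperspace X = {A. closedin X A \<and> A \<noteq> {}}"

definition hausdorff_ball :: "'a topology \<Rightarrow> 'a set \<Rightarrow> 'a set set \<Rightarrow> 'a set set" where
  "hausdorff_ball X A \<U> =
     {B \<in> hyperspace X. A \<subseteq> star_of_set B \<U> \<and> B \<subseteq> star_of_set A \<U>}"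

definition hyperspace_entourage :: "'a topology \<Rightarrow> 'a set set \<Rightarrow> ('a set \<times> 'a set) set" where
  "hyperspace_entourage X \<U> =
     (\<Union>A\<in>hyperspace X. hausdorff_ball X A \<U> \<times> hausdorff_ball X A \<U>)"

text \<open>As in the type class of uniform spaces, a uniformity is a filter on pairs; the topology
  follows the axiom of \<^class>\<open>open_uniformity\<close>, relativised to the hyperspace.\<close>

definition hyperspace_uniformity :: "'a topology \<Rightarrow> 'a set set set \<Rightarrow> ('a set \<times> 'a set) filter" where
  "hyperspace_uniformity X \<O> = (INF \<U>\<in>\<O>. principal (hyperspace_entourage X \<U>))"

definition uniform_topology :: "'a topology \<Rightarrow> 'a set set set \<Rightarrow> 'a set topology" where
  "uniform_topology X \<O> = topology (\<lambda>\<G>. \<G> \<subseteq> hyperspace X \<and>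
     (\<forall>A\<in>\<G>. eventually (\<lambda>(A', B). A' = A \<longrightarrow> B \<in> \<G>) (hyperspace_uniformity X \<O>)))"

lemma openin_uniform_topology:
  "openin (uniform_topology X \<O>) \<G> \<longleftrightarrow> \<G> \<subseteq> hyperspace X \<and>
     (\<forall>A\<in>\<G>. eventually (\<lambda>(A', B). A' = A \<longrightarrow> B \<in> \<G>) (hyperspace_uniformity X \<O>))"
proof -
  let ?F = "hyperspace_uniformity X \<O>"
  let ?P = "\<lambda>\<G>. \<G> \<subseteq> hyperspace X \<and>
     (\<forall>A\<in>\<G>. eventually (\<lambda>(A', B). A' = A \<longrightarrow> B \<in> \<G>) ?F)"
  have Int: "?P (\<G> \<inter> \<H>)" if G: "?P \<G>" and H: "?P \<H>" for \<G> \<H>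
  proof (intro conjI ballI)
    fix A assume A: "A \<in> \<G> \<inter> \<H>"
    have "eventually (\<lambda>(A', B). A' = A \<longrightarrow> B \<in> \<G>) ?F"
      using G A by (elim conjE) (rule bspec, assumption, simp)
    moreover have "eventually (\<lambda>(A', B). A' = A \<longrightarrow> B \<in> \<H>) ?F"
      using H A by (elim conjE) (rule bspec, assumption, simp)
    ultimately show "eventually (\<lambda>(A', B). A' = A \<longrightarrow> B \<in> \<G> \<inter> \<H>) ?F"
      by eventually_elim (clarsimp split: prod.splits)
  qed (use G in \<open>simp add: le_infI1\<close>)
  have Union: "?P (\<Union>\<K>)" if K: "\<forall>\<G>\<in>\<K>. ?P \<G>" for \<K>
  proof (intro conjI ballI)
    show "\<Union>\<K> \<subseteq> hyperspace X"
      by (rule Union_least) (use K in simp)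
    fix A assume "A \<in> \<Union>\<K>"
    then obtain \<G> where G: "\<G> \<in> \<K>" "A \<in> \<G>"
      by (rule UnionE)
    have "eventually (\<lambda>(A', B). A' = A \<longrightarrow> B \<in> \<G>) ?F"
      using bspec[OF K G(1)] G(2) by (elim conjE) (rule bspec)
    then show "eventually (\<lambda>(A', B). A' = A \<longrightarrow> B \<in> \<Union>\<K>) ?F"
      by (rule eventually_mono) (use G(1) in \<open>clarsimp, blast\<close>)
  qed
  have "istopology ?P"
    unfolding istopology_def
  proof (rule conjI; intro allI impI)
    show "?P (\<G> \<inter> \<H>)" if "?P \<G>" "?P \<H>" for \<G> \<H>
      using that by (rule Int)
    show "?P (\<Union>\<K>)" if "\<forall>\<G>\<in>\<K>. ?P \<G>" for \<K>
      using that by (rule Union)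
  qed
  then show ?thesis
    by (simp add: uniform_topology_def topology_inverse')
qed

lemma half_refines_entourage_mono:
  assumes "half_refines \<W> \<U>"
  shows "hyperspace_entourage X \<W> \<subseteq> hyperspace_entourage X \<U>"
proof -
  have star: "star_of_set Y \<W> \<subseteq> star_of_set Y \<U>" for Y
  proof
    fix x assume "x \<in> star_of_set Y \<W>"
    then obtain W where W: "W \<in> \<W>" "Y \<inter> W \<noteq> {}" "x \<in> W"
      by (auto simp: star_of_set_def)
    then have "W \<inter> W \<noteq> {}"
      by auto
    then have "\<exists>U\<in>\<U>. W \<union> W \<subseteq> U"
      using assms[unfolded half_refines_def, rule_format, OF W(1) W(1)] by simp
    then obtain U where "U \<in> \<U>" "W \<subseteq> U"
      by auto
    with W show "x \<in> star_of_set Y \<U>"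
      by (auto simp: star_of_set_def)
  qed
  have "hausdorff_ball X A \<W> \<subseteq> hausdorff_ball X A \<U>" for A
    using subset_trans[OF _ star] by (auto simp only: hausdorff_ball_def)
  then show ?thesis
    unfolding hyperspace_entourage_def by (intro UN_mono Sigma_mono subset_refl)
qed

lemma eventually_hyperspace_uniformity:
  assumes "admissible X \<O>" "topspace X \<noteq> {}"
  shows "eventually P (hyperspace_uniformity X \<O>) \<longleftrightarrow>
           (\<exists>\<U>\<in>\<O>. \<forall>p\<in>hyperspace_entourage X \<U>. P p)"
proof -
  have base: "openin X = arbitrary union_of (\<lambda>S. \<exists>x\<in>topspace X. \<exists>\<U>\<in>\<O>. S = star_of_set {x} \<U>)"
    using assms(1) unfolding admissible_def by (elim conjE)
  have ne: "\<O> \<noteq> {}"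
  proof
    assume "\<O> = {}"
    then have "openin X = arbitrary union_of (\<lambda>_. False)"
      using base by (simp only: bex_empty bex_triv simp_thms)
    then have "(arbitrary union_of (\<lambda>_. False)) (topspace X)"
      using openin_topspace[of X] by (rule fun_cong[THEN iffD1])
    then show False
      using assms(2) unfolding union_of_def by auto
  qed
  have "\<exists>\<W>\<in>\<O>. principal (hyperspace_entourage X \<W>) \<le>
      inf (principal (hyperspace_entourage X \<U>)) (principal (hyperspace_entourage X \<V>))"
    if UV: "\<U> \<in> \<O>" "\<V> \<in> \<O>" for \<U> \<V>
  proof -
    have "\<forall>\<U>\<in>\<O>. \<forall>\<V>\<in>\<O>. \<exists>\<W>\<in>\<O>. half_refines \<W> \<U> \<and> half_refines \<W> \<V>"
      using assms(1) unfolding admissible_def by (elim conjE)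
    with UV obtain \<W> where "\<W> \<in> \<O>" "half_refines \<W> \<U>" "half_refines \<W> \<V>"
      by blast
    then show ?thesis
      by (intro bexI[of _ \<W>]) (simp_all add: half_refines_entourage_mono)
  qed
  then show ?thesis
    unfolding hyperspace_uniformity_def eventually_principal[symmetric]
    by (intro eventually_INF_base ne)
qed

lemma topspace_uniform_topology:
  assumes "admissible X \<O>"
  shows "topspace (uniform_topology X \<O>) = hyperspace X"
proof
  show "topspace (uniform_topology X \<O>) \<subseteq> hyperspace X"
    unfolding topspace_def by (auto simp: openin_uniform_topology)
  have "eventually (\<lambda>(A', B). A' = A \<longrightarrow> B \<in> hyperspace X) (hyperspace_uniformity X \<O>)"
    if "A \<in> hyperspace X" for A
  proof -
    have ne: "topspace X \<noteq> {}"
      using that closedin_subset[of X A] by (auto simp: hyperspace_def)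
    then have "\<exists>\<U>. \<U> \<in> \<O>"
      using eventually_hyperspace_uniformity[OF assms, of "\<lambda>_. True"] by auto
    then show ?thesis
      unfolding eventually_hyperspace_uniformity[OF assms ne]
      by (auto simp: hyperspace_entourage_def hausdorff_ball_def)
  qed
  then show "hyperspace X \<subseteq> topspace (uniform_topology X \<O>)"
    by (intro openin_subset) (simp add: openin_uniform_topology)
qed

section \<open>Nets and Kuratowski convergence\<close>

text \<open>A net is a family \<open>F :: 'i \<Rightarrow> _\<close> restricted to a carrier \<open>\<Lambda>\<close> directed by the preorder
  \<open>r\<close>, where \<open>(i, j) \<in> r\<close> reads as \<open>i \<le> j\<close>. Values of \<open>F\<close> outside \<open>\<Lambda>\<close> are irrelevant.\<close>

definition directed_set :: "'i set \<Rightarrow> 'i rel \<Rightarrow> bool" where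
  "directed_set \<Lambda> r \<longleftrightarrow> preorder_on \<Lambda> r \<and> \<Lambda> \<noteq> {} \<and>
     (\<forall>i\<in>\<Lambda>. \<forall>j\<in>\<Lambda>. \<exists>k\<in>\<Lambda>. (i, k) \<in> r \<and> (j, k) \<in> r)"

definition net_residually :: "'i set \<Rightarrow> 'i rel \<Rightarrow> ('i \<Rightarrow> bool) \<Rightarrow> bool" where
  "net_residually \<Lambda> r P \<longleftrightarrow> (\<exists>i\<in>\<Lambda>. \<forall>j\<in>\<Lambda>. (i, j) \<in> r \<longrightarrow> P j)"

definition net_frequently :: "'i set \<Rightarrow> 'i rel \<Rightarrow> ('i \<Rightarrow> bool) \<Rightarrow> bool" where
  "net_frequently \<Lambda> r P \<longleftrightarrow> (\<forall>i\<in>\<Lambda>. \<exists>j\<in>\<Lambda>. (i, j) \<in> r \<and> P j)"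

definition tails_filter :: "'i set \<Rightarrow> 'i rel \<Rightarrow> 'i filter" where
  "tails_filter \<Lambda> r = (INF i\<in>\<Lambda>. principal {j\<in>\<Lambda>. (i, j) \<in> r})"

lemma eventually_tails_filter:
  assumes "directed_set \<Lambda> r"
  shows "eventually P (tails_filter \<Lambda> r) \<longleftrightarrow> net_residually \<Lambda> r P"
proof -
  have "\<exists>k\<in>\<Lambda>. principal {l\<in>\<Lambda>. (k, l) \<in> r} \<le>
      inf (principal {l\<in>\<Lambda>. (i, l) \<in> r}) (principal {l\<in>\<Lambda>. (j, l) \<in> r})"
    if ij: "i \<in> \<Lambda>" "j \<in> \<Lambda>" for i j
  proof -
    have "trans r"
      using assms by (simp add: directed_set_def preorder_on_def)
    moreover obtain k where "k \<in> \<Lambda>" "(i, k) \<in> r" "(j, k) \<in> r"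
      using assms ij unfolding directed_set_def by blast
    ultimately show ?thesis
      by (intro bexI[of _ k]) (auto dest: transD)
  qed
  then show ?thesis
    using assms unfolding tails_filter_def net_residually_def directed_set_def
    by (subst eventually_INF_base) (auto simp: eventually_principal)
qed

definition limsup_net :: "'a topology \<Rightarrow> 'i set \<Rightarrow> 'i rel \<Rightarrow> ('i \<Rightarrow> 'a set) \<Rightarrow> 'a set" where
  "limsup_net X \<Lambda> r F = {x \<in> topspace X.
     \<forall>U. openin X U \<and> x \<in> U \<longrightarrow> net_frequently \<Lambda> r (\<lambda>i. U \<inter> F i \<noteq> {})}"

definition liminf_net :: "'a topology \<Rightarrow> 'i set \<Rightarrow> 'i rel \<Rightarrow> ('i \<Rightarrow> 'a set) \<Rightarrow> 'a set" where
  "liminf_net X \<Lambda> r F = {x \<in> topspace X.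
     \<forall>U. openin X U \<and> x \<in> U \<longrightarrow> net_residually \<Lambda> r (\<lambda>i. U \<inter> F i \<noteq> {})}"

definition kuratowski_convergent ::
  "'a topology \<Rightarrow> 'i set \<Rightarrow> 'i rel \<Rightarrow> ('i \<Rightarrow> 'a set) \<Rightarrow> 'a set \<Rightarrow> bool" where
  "kuratowski_convergent X \<Lambda> r F L \<longleftrightarrow>
     L = limsup_net X \<Lambda> r F \<and> L = liminf_net X \<Lambda> r F"

end

theory Submission
  imports Defs
begin

text \<open>A basic uniform neighbourhood of \<open>K\<close> is given by a covering \<open>\<U>\<close>, and a set lies in it as
  soon as it lies in the Hausdorff ball of \<open>K\<close>, because \<open>K\<close> lies in that ball too. The two halves
  of membership in the ball come from the two halves of Kuratowski convergence, each by one finite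
  subcover. The upper limit controls \<open>K\<^sub>\<lambda> \<subseteq> St[K, \<U>]\<close>: the complement of the open set
  \<open>St[K, \<U>]\<close> is compact, and each of its points has a neighbourhood that the net eventually
  misses (\<open>residually_subset_openin\<close>). The lower limit controls \<open>K \<subseteq> St[K\<^sub>\<lambda>, \<U>]\<close>: the compact
  set \<open>K\<close> is covered by finitely many members of \<open>\<U>\<close>, each of which the net eventually meets
  (\<open>residually_subset_star\<close>).\<close>

lemma openin_star_of_set:
  assumes "open_covering X \<U>"
  shows "openin X (star_of_set Y \<U>)"
  using assms by (auto simp: star_of_set_def open_covering_def)

lemma subset_star_of_set:
  assumes "open_covering X \<U>" "Y \<subseteq> topspace X"
  shows "Y \<subseteq> star_of_set Y \<U>"
proof
  fix y assume "y \<in> Y"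
  with assms obtain U where "U \<in> \<U>" "y \<in> U"
    unfolding open_covering_def by (metis UnionE subsetD)
  with \<open>y \<in> Y\<close> show "y \<in> star_of_set Y \<U>"
    by (auto simp: star_of_set_def)
qed

lemma not_net_frequently_iff:
  assumes "directed_set \<Lambda> r"
  shows "\<not> net_frequently \<Lambda> r P \<longleftrightarrow> eventually (\<lambda>i. \<not> P i) (tails_filter \<Lambda> r)"
  by (auto simp: eventually_tails_filter[OF assms] net_residually_def net_frequently_def)

lemma eventually_tails_filter_carrier:
  assumes "directed_set \<Lambda> r"
  shows "eventually (\<lambda>i. i \<in> \<Lambda>) (tails_filter \<Lambda> r)"
  using assms by (auto simp: eventually_tails_filter net_residually_def directed_set_def)

text \<open>Each point outside \<open>G\<close> is not a cluster point of the net, hence has an open neighbourhood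
  that the net eventually misses; finitely many of these cover the compact complement of \<open>G\<close>.\<close>

lemma residually_subset_openin:
  assumes "compact_space X" "directed_set \<Lambda> r" "openin X G" "limsup_net X \<Lambda> r F \<subseteq> G"
    and F: "\<And>i. i \<in> \<Lambda> \<Longrightarrow> F i \<subseteq> topspace X"
  shows "eventually (\<lambda>i. F i \<subseteq> G) (tails_filter \<Lambda> r)"
proof -
  define \<M> where "\<M> = {U. openin X U \<and> eventually (\<lambda>i. U \<inter> F i = {}) (tails_filter \<Lambda> r)}"
  have "compactin X (topspace X - G)"
    using assms(1,3) by (simp add: closedin_compact_space closedin_diff)
  moreover have "topspace X - G \<subseteq> \<Union>\<M>"
  proof
    fix x assume x: "x \<in> topspace X - G"
    then obtain U where "openin X U" "x \<in> U" "\<not> net_frequently \<Lambda> r (\<lambda>i. U \<inter> F i \<noteq> {})"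
      using assms(4) by (auto simp: limsup_net_def)
    then show "x \<in> \<Union>\<M>"
      by (auto simp: \<M>_def not_net_frequently_iff[OF assms(2)])
  qed
  ultimately obtain \<N> where N: "finite \<N>" "\<N> \<subseteq> \<M>" "topspace X - G \<subseteq> \<Union>\<N>"
    using compactinD[of X "topspace X - G" \<M>] by (auto simp: \<M>_def)
  have "eventually (\<lambda>i. \<forall>U\<in>\<N>. U \<inter> F i = {}) (tails_filter \<Lambda> r)"
    using N(1,2) by (intro eventually_ball_finite) (auto simp: \<M>_def)
  with eventually_tails_filter_carrier[OF assms(2)] show ?thesis
    by eventually_elim (use N(3) F in blast)
qed

text \<open>Finitely many members of \<open>\<U>\<close> that meet \<open>C\<close> cover \<open>C\<close>. Each of them is a neighbourhood of a
  point of the lower limit, so it eventually meets the net and thus lies in the star of the net.\<close>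

lemma residually_subset_star:
  assumes "compactin X C" "directed_set \<Lambda> r" "open_covering X \<U>" "C \<subseteq> liminf_net X \<Lambda> r F"
  shows "eventually (\<lambda>i. C \<subseteq> star_of_set (F i) \<U>) (tails_filter \<Lambda> r)"
proof -
  define \<M> where "\<M> = {U \<in> \<U>. C \<inter> U \<noteq> {}}"
  have "C \<subseteq> \<Union>\<M>"
    using subset_star_of_set[OF assms(3) compactin_subset_topspace[OF assms(1)]]
    by (simp add: \<M>_def star_of_set_def)
  then obtain \<N> where N: "finite \<N>" "\<N> \<subseteq> \<M>" "C \<subseteq> \<Union>\<N>"
    using compactinD[OF assms(1), of \<M>] assms(3) by (auto simp: \<M>_def open_covering_def)
  have "eventually (\<lambda>i. U \<inter> F i \<noteq> {}) (tails_filter \<Lambda> r)" if U: "U \<in> \<N>" for U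
  proof -
    have "openin X U"
      using U N(2) assms(3) by (auto simp: \<M>_def open_covering_def)
    moreover obtain x where "x \<in> liminf_net X \<Lambda> r F" "x \<in> U"
      using U N(2) assms(4) unfolding \<M>_def by blast
    ultimately show ?thesis
      by (simp add: liminf_net_def eventually_tails_filter[OF assms(2)])
  qed
  then have "eventually (\<lambda>i. \<forall>U\<in>\<N>. U \<inter> F i \<noteq> {}) (tails_filter \<Lambda> r)"
    using N(1) by (intro eventually_ball_finite) auto
  then show ?thesis
  proof eventually_elim
    case (elim i)
    then have "\<Union>\<N> \<subseteq> star_of_set (F i) \<U>"
      using N(2) unfolding star_of_set_def \<M>_def by blast
    with N(3) show ?case
      by (rule subset_trans)
  qed
qed

lemma hausdorff_ball_imp_entourage:
  assumes "open_covering X \<U>" "A \<in> hyperspace X" "B \<in> hausdorff_ball X A \<U>"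
  shows "(A, B) \<in> hyperspace_entourage X \<U>"
proof -
  have "A \<in> hausdorff_ball X A \<U>"
    using assms subset_star_of_set[of X \<U> A] closedin_subset[of X A]
    by (simp add: hausdorff_ball_def hyperspace_def)
  then show ?thesis
    using assms by (auto simp: hyperspace_entourage_def)
qed

theorem theorem6:
  fixes X :: "'a topology" and \<O> :: "'a set set set"
    and \<Lambda> :: "'i set" and r :: "'i rel" and Ks :: "'i \<Rightarrow> 'a set" and K :: "'a set"
  assumes "compact_space X"
    and "admissible X \<O>"
    and "directed_set \<Lambda> r"
    and "\<And>i. i \<in> \<Lambda> \<Longrightarrow> Ks i \<in> hyperspace X"
    and "K \<in> hyperspace X"
    and "kuratowski_convergent X \<Lambda> r Ks K"
  shows "limitin (uniform_topology X \<O>) Ks K (tails_filter \<Lambda> r)"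
  unfolding limitin_def
proof (intro conjI allI impI)
  show "K \<in> topspace (uniform_topology X \<O>)"
    using assms(2,5) by (simp add: topspace_uniform_topology)
next
  fix \<G> assume G: "openin (uniform_topology X \<O>) \<G> \<and> K \<in> \<G>"
  have K: "closedin X K" "K \<noteq> {}" "K \<subseteq> topspace X"
    using assms(5) closedin_subset by (auto simp: hyperspace_def)
  have "eventually (\<lambda>(A', B). A' = K \<longrightarrow> B \<in> \<G>) (hyperspace_uniformity X \<O>)"
    using G by (simp add: openin_uniform_topology)
  moreover have "topspace X \<noteq> {}"
    using K(2,3) by auto
  ultimately obtain \<U> where U: "\<U> \<in> \<O>"
      "\<And>B. (K, B) \<in> hyperspace_entourage X \<U> \<Longrightarrow> B \<in> \<G>"
    using eventually_hyperspace_uniformity[OF assms(2)] by fastforce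
  have lim: "limsup_net X \<Lambda> r Ks = K" "liminf_net X \<Lambda> r Ks = K"
    using assms(6)[unfolded kuratowski_convergent_def, THEN conjunct1, symmetric]
      assms(6)[unfolded kuratowski_convergent_def, THEN conjunct2, symmetric] .
  have cov: "open_covering X \<U>"
    using assms(2) U(1) by (simp add: admissible_def)
  have "eventually (\<lambda>i. Ks i \<subseteq> star_of_set K \<U>) (tails_filter \<Lambda> r)"
  proof (rule residually_subset_openin[OF assms(1,3) openin_star_of_set[OF cov]])
    show "limsup_net X \<Lambda> r Ks \<subseteq> star_of_set K \<U>"
      using subset_star_of_set[OF cov K(3)] by (simp only: lim)
    show "Ks i \<subseteq> topspace X" if "i \<in> \<Lambda>" for i
      using assms(4)[OF that] closedin_subset by (auto simp: hyperspace_def)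
  qed
  moreover have "eventually (\<lambda>i. K \<subseteq> star_of_set (Ks i) \<U>) (tails_filter \<Lambda> r)"
  proof (rule residually_subset_star[OF _ assms(3) cov])
    show "compactin X K"
      using assms(1) K(1) by (rule closedin_compact_space)
    show "K \<subseteq> liminf_net X \<Lambda> r Ks"
      by (simp only: lim subset_refl)
  qed
  ultimately show "eventually (\<lambda>i. Ks i \<in> \<G>) (tails_filter \<Lambda> r)"
    using eventually_tails_filter_carrier[OF assms(3)]
  proof eventually_elim
    case (elim i)
    then have "Ks i \<in> hausdorff_ball X K \<U>"
      using assms(4) by (simp add: hausdorff_ball_def)
    then show ?case
      using U(2) hausdorff_ball_imp_entourage[OF cov assms(5)] by blast
  qed
qed

end
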